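(* Let $G$ be a connected graph. If every MNS ordering of $G$ is also a LexBFS ordering of $G$, then $G$ is $\{P_4, C_4\}$-free.
   Context: All graphs are finite and simple. For an ordering $\sigma$ of $V(G)$ write $x<_\sigma y$ if $x$ precedes $y$. In each of the following, the condition is required for all $a<_\sigma b<_\sigma c$ with $ac\in E(G)$ and $ab\notin E(G)$: $\sigma$ is a LexBFS ordering if there is $d$ with $d<_\sigma a$, $db\in E(G)$, $dc\notin E(G)$; an MNS ordering if there is $d$ with $d<_\sigma b$, $db\in E(G)$, $dc\notin E(G)$. $\{P_4,C_4\}$-free means no induced path on 4 vertices and no induced 4-cycle. *)

theory Defs
  imports "Graph_Theory.Graph_Theory" "HOL-Combinatorics.Multiset_Permutations"
begin

text \<open>
  A finite simple graph is a \<^locale>\<open>pair_graph\<close>: a finite, loop-free, symmetric digraph whose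
  arcs are pairs of vertices, so that $xy \in E(G)$ is rendered as \<open>(x, y) \<in> parcs G\<close>.
  An ordering of $V(G)$ is a list containing every vertex exactly once, that is, an element of
  \<open>permutations_of_set (pverts G)\<close>.
\<close>

definition precedes :: "'a list \<Rightarrow> 'a \<Rightarrow> 'a \<Rightarrow> bool" where
  "precedes \<sigma> x y \<longleftrightarrow> (\<exists>i j. i < j \<and> j < length \<sigma> \<and> \<sigma> ! i = x \<and> \<sigma> ! j = y)"

definition LexBFS_ordering :: "'a pair_pre_digraph \<Rightarrow> 'a list \<Rightarrow> bool" where
  "LexBFS_ordering G \<sigma> \<longleftrightarrow> \<sigma> \<in> permutations_of_set (pverts G) \<and>
     (\<forall>a b c. precedes \<sigma> a b \<and> precedes \<sigma> b c \<and> (a, c) \<in> parcs G \<and> (a, b) \<notin> parcs G \<longrightarrow>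
        (\<exists>d. precedes \<sigma> d a \<and> (d, b) \<in> parcs G \<and> (d, c) \<notin> parcs G))"

definition MNS_ordering :: "'a pair_pre_digraph \<Rightarrow> 'a list \<Rightarrow> bool" where
  "MNS_ordering G \<sigma> \<longleftrightarrow> \<sigma> \<in> permutations_of_set (pverts G) \<and>
     (\<forall>a b c. precedes \<sigma> a b \<and> precedes \<sigma> b c \<and> (a, c) \<in> parcs G \<and> (a, b) \<notin> parcs G \<longrightarrow>
        (\<exists>d. precedes \<sigma> d b \<and> (d, b) \<in> parcs G \<and> (d, c) \<notin> parcs G))"

definition P4 :: "nat pair_pre_digraph" where
  "P4 = \<lparr> pverts = {0, 1, 2, 3}, parcs = {(0, 1), (1, 0), (1, 2), (2, 1), (2, 3), (3, 2)} \<rparr>"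

definition C4 :: "nat pair_pre_digraph" where
  "C4 = \<lparr> pverts = {0, 1, 2, 3},
          parcs = {(0, 1), (1, 0), (1, 2), (2, 1), (2, 3), (3, 2), (3, 0), (0, 3)} \<rparr>"

definition induced_free :: "nat pair_pre_digraph set \<Rightarrow> 'a pair_pre_digraph \<Rightarrow> bool" where
  "induced_free \<H> G \<longleftrightarrow>
     \<not> (\<exists>H \<in> \<H>. \<exists>K. induced_subgraph K (with_proj G) \<and> digraph_iso K (with_proj H))"

end

theory Submission
  imports Defs
begin

text \<open>
  An induced $P_4$ or $C_4$ provides edges $au$, $ub$, $ac$ and non-edges $ab$, $uc$. Run a maximal
  neighbourhood search that visits $a$ and $u$ first and afterwards always takes a vertex whose set of
  visited neighbours is maximal among those containing the visited neighbours of $b$, until $b$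
  itself is taken. Every vertex taken in this phase is adjacent to $u$, so $c$ is visited after $b$.
  As $a$ has no predecessor, the triple $a, b, c$ violates the LexBFS condition.
\<close>

definition visited_nbrs :: "'a pair_pre_digraph \<Rightarrow> 'a list \<Rightarrow> 'a \<Rightarrow> 'a set" where
  "visited_nbrs G xs v = {d \<in> set xs. (d, v) \<in> parcs G}"

text \<open>Partial runs of the search rather than finished orderings: inclusion-maximal candidates
  may tie or be incomparable, and a run built step by step can be steered through these
  choices.\<close>

inductive MNS_prefix :: "'a pair_pre_digraph \<Rightarrow> 'a list \<Rightarrow> bool" for G where
  Nil: "MNS_prefix G []"
| snoc: "MNS_prefix G xs \<Longrightarrow> b \<in> pverts G - set xs \<Longrightarrow>
    (\<And>c. c \<in> pverts G - set xs \<Longrightarrow> \<not> visited_nbrs G xs b \<subset> visited_nbrs G xs c) \<Longrightarrow>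
    MNS_prefix G (xs @ [b])"

text \<open>Splitting at \<open>y\<close> exposes \<open>ps\<close>, the set of vertices already
  visited when \<open>y\<close> is chosen, which is what the search rule speaks about.\<close>

lemma precedes_iff_split:
  "precedes \<sigma> x y \<longleftrightarrow> (\<exists>ps qs. \<sigma> = ps @ y # qs \<and> x \<in> set ps)"
proof
  assume "precedes \<sigma> x y"
  then obtain i j where ij: "i < j" "j < length \<sigma>" "\<sigma> ! i = x" "\<sigma> ! j = y"
    unfolding precedes_def by blast
  then have "\<sigma> = take j \<sigma> @ y # drop (Suc j) \<sigma>"
    using id_take_nth_drop by blast
  moreover have "x \<in> set (take j \<sigma>)"
    using ij by (auto simp: in_set_conv_nth intro!: exI[of _ i])
  ultimately show "\<exists>ps qs. \<sigma> = ps @ y # qs \<and> x \<in> set ps" by blast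
next
  assume "\<exists>ps qs. \<sigma> = ps @ y # qs \<and> x \<in> set ps"
  then obtain ps qs i where "\<sigma> = ps @ y # qs" "i < length ps" "ps ! i = x"
    by (auto simp: in_set_conv_nth)
  then show "precedes \<sigma> x y"
    unfolding precedes_def by (intro exI[of _ i] exI[of _ "length ps"]) (auto simp: nth_append)
qed

lemma MNS_prefix_distinct: "MNS_prefix G xs \<Longrightarrow> distinct xs"
  by (induction rule: MNS_prefix.induct) auto

lemma MNS_prefix_subset: "MNS_prefix G xs \<Longrightarrow> set xs \<subseteq> pverts G"
  by (induction rule: MNS_prefix.induct) auto

lemma MNS_prefix_maximal:
  assumes "MNS_prefix G xs" "xs = ps @ b # qs" "c \<in> pverts G - set ps"
  shows "\<not> visited_nbrs G ps b \<subset> visited_nbrs G ps c"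
  using assms
proof (induction arbitrary: qs rule: MNS_prefix.induct)
  case Nil
  then show ?case by simp
next
  case (snoc xs v)
  then show ?case
    \<comment> \<open>Either \<open>b\<close> is the vertex just appended, and the rule gives
      maximality, or the last entry of \<open>qs\<close> is dropped and the induction hypothesis
      applies.\<close>
    by (cases qs rule: rev_cases) auto
qed

text \<open>When \<open>b\<close> is chosen, \<open>c\<close> is still unvisited and
  \<open>a\<close> is a visited neighbour of \<open>c\<close> but not of \<open>b\<close>. If every
  visited neighbour of \<open>b\<close> were adjacent to \<open>c\<close>, the inclusion would be
  strict because of \<open>a\<close>, against maximality; hence some \<open>d\<close>
  exists.\<close>

lemma MNS_ordering_if_prefix:
  assumes "MNS_prefix G xs" "set xs = pverts G"
  shows "MNS_ordering G xs"
  unfolding MNS_ordering_def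
proof (intro conjI allI impI)
  show "xs \<in> permutations_of_set (pverts G)"
    using assms MNS_prefix_distinct by (auto simp: permutations_of_set_def)
  fix a b c
  assume H: "precedes xs a b \<and> precedes xs b c \<and> (a, c) \<in> parcs G \<and> (a, b) \<notin> parcs G"
  then obtain ps qs where split: "xs = ps @ b # qs" and a: "a \<in> set ps"
    by (auto simp: precedes_iff_split)
  obtain rs ts where split': "xs = rs @ c # ts" and b: "b \<in> set rs"
    using H by (auto simp: precedes_iff_split)
  have dist: "distinct xs" using assms MNS_prefix_distinct by blast
  \<comment> \<open>Otherwise uniqueness of the position of \<open>c\<close> would force
    \<open>b\<close> to occur before its own position.\<close>
  have "c \<notin> set ps"
  proof
    assume "c \<in> set ps"
    then obtain ps1 ps2 where ps: "ps = ps1 @ c # ps2" by (auto simp: in_set_conv_decomp)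
    then have "rs @ c # ts = ps1 @ c # (ps2 @ b # qs)" using split split' by simp
    moreover have "c \<notin> set rs" "c \<notin> set ts"
      using dist split' by auto
    ultimately have "rs = ps1"
      using append_Cons_eq_iff by metis
    then show False using b dist split ps by auto
  qed
  moreover have "c \<in> pverts G" using split' assms by auto
  ultimately have "\<not> visited_nbrs G ps b \<subset> visited_nbrs G ps c"
    using MNS_prefix_maximal[OF assms(1) split] by blast
  moreover have "a \<in> visited_nbrs G ps c" "a \<notin> visited_nbrs G ps b"
    using a H by (auto simp: visited_nbrs_def)
  ultimately obtain d where "d \<in> set ps" "(d, b) \<in> parcs G" "(d, c) \<notin> parcs G"
    by (auto simp: visited_nbrs_def)
  then show "\<exists>d. precedes xs d b \<and> (d, b) \<in> parcs G \<and> (d, c) \<notin> parcs G"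
    using split precedes_iff_split by metis
qed

text \<open>Always take a \<open>v\<close> that is maximal among the unvisited vertices whose
  visited neighbours include those of \<open>b\<close>. It is maximal among all unvisited vertices,
  since anything strictly above \<open>v\<close> also lies above \<open>b\<close>. The unvisited set
  shrinks, so \<open>b\<close> is eventually taken.\<close>

lemma MNS_prefix_reach:
  assumes "finite (pverts G)" "MNS_prefix G xs" "b \<in> pverts G - set xs"
  shows "\<exists>ys. MNS_prefix G (xs @ ys @ [b]) \<and>
    (\<forall>y \<in> set ys. visited_nbrs G xs b \<subseteq> visited_nbrs G xs y)"
  using assms(2,3)
proof (induction "card (pverts G - set xs)" arbitrary: xs rule: less_induct)
  case less
  let ?L = "visited_nbrs G xs"
  let ?C = "{v \<in> pverts G - set xs. ?L b \<subseteq> ?L v}"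
  have "finite (?L ` ?C)" "?L b \<in> ?L ` ?C"
    using assms(1) less.prems by auto
  then obtain v where v: "v \<in> ?C" and max: "\<And>w. w \<in> ?C \<Longrightarrow> ?L v \<subseteq> ?L w \<Longrightarrow> ?L v = ?L w"
    using finite_has_maximal2[of "?L ` ?C" "?L b"] by (smt (verit) imageE imageI)
  have "\<not> ?L v \<subset> ?L c" if "c \<in> pverts G - set xs" for c
    using v max[of c] that by blast
  then have pre: "MNS_prefix G (xs @ [v])"
    using less.prems v by (intro MNS_prefix.snoc) auto
  show ?case
  proof (cases "v = b")
    case True
    then show ?thesis using pre by (intro exI[of _ "[]"]) auto
  next
    case False
    have "card (pverts G - set (xs @ [v])) < card (pverts G - set xs)"
      using v assms(1) by (intro psubset_card_mono) auto
    from less.hyps[OF this pre] False less.prems obtain ys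
      where ys: "MNS_prefix G ((xs @ [v]) @ ys @ [b])"
        "\<forall>y \<in> set ys. visited_nbrs G (xs @ [v]) b \<subseteq> visited_nbrs G (xs @ [v]) y"
      by auto
    have xs: "v \<notin> set xs" using v by simp
    \<comment> \<open>The induction hypothesis compares neighbourhoods within
      \<open>xs @ [v]\<close>; restricting both sides to \<open>xs\<close> keeps the
      inclusion.\<close>
    have "?L b \<subseteq> ?L y" if "y \<in> set ys" for y
      using ys(2) that xs unfolding visited_nbrs_def by fastforce
    then show ?thesis
      using ys(1) v by (intro exI[of _ "v # ys"]) auto
  qed
qed

lemma MNS_prefix_complete:
  assumes "finite (pverts G)" "MNS_prefix G xs"
  shows "\<exists>ys. MNS_prefix G (xs @ ys) \<and> set (xs @ ys) = pverts G"
  using assms(2)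
proof (induction "card (pverts G - set xs)" arbitrary: xs rule: less_induct)
  case less
  show ?case
  proof (cases "set xs = pverts G")
    case True
    then show ?thesis using less.prems by (intro exI[of _ "[]"]) auto
  next
    case False
    then obtain b where b: "b \<in> pverts G - set xs"
      using MNS_prefix_subset[OF less.prems] by blast
    then obtain ys where ys: "MNS_prefix G (xs @ ys @ [b])"
      using MNS_prefix_reach[OF assms(1) less.prems] by blast
    have "card (pverts G - set (xs @ ys @ [b])) < card (pverts G - set xs)"
      using b assms(1) by (intro psubset_card_mono) auto
    from less.hyps[OF this ys] obtain zs
      where "MNS_prefix G ((xs @ ys @ [b]) @ zs)" "set ((xs @ ys @ [b]) @ zs) = pverts G" by blast
    then show ?thesis by (intro exI[of _ "ys @ b # zs"]) auto
  qed
qed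

lemma MNS_ordering_not_LexBFS:
  assumes "pair_graph G"
    and E: "(a, u) \<in> parcs G" "(u, b) \<in> parcs G" "(a, c) \<in> parcs G"
    and N: "(a, b) \<notin> parcs G" "(u, c) \<notin> parcs G"
    and "a \<noteq> b" "u \<noteq> c"
  shows "\<exists>\<sigma>. MNS_ordering G \<sigma> \<and> \<not> LexBFS_ordering G \<sigma>"
proof -
  interpret pair_graph G by fact
  have V: "a \<in> pverts G" "u \<in> pverts G" "b \<in> pverts G" "c \<in> pverts G"
    using E by (auto dest: in_arcsD1 in_arcsD2)
  have ne: "a \<noteq> u" "u \<noteq> b" "a \<noteq> c" "b \<noteq> c"
    using E(2) N(2) no_loops[OF E(1)] no_loops[OF E(2)] no_loops[OF E(3)] by auto
  \<comment> \<open>Any vertex may start, as all visited neighbourhoods are empty. Next,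
    \<open>u\<close> sees the whole visited set {a}, so nothing can exceed it.\<close>
  have "MNS_prefix G ([] @ [a])"
    using V by (intro MNS_prefix.intros) (auto simp: visited_nbrs_def)
  then have "MNS_prefix G ([a] @ [u])"
    using V E ne by (intro MNS_prefix.snoc) (auto simp: visited_nbrs_def)
  then have au: "MNS_prefix G [a, u]" by simp
  obtain ys where ys: "MNS_prefix G ([a, u] @ ys @ [b])"
      "\<forall>y \<in> set ys. visited_nbrs G [a, u] b \<subseteq> visited_nbrs G [a, u] y"
    using MNS_prefix_reach[OF _ au, of b] V ne assms by auto
  obtain zs where zs: "MNS_prefix G (([a, u] @ ys @ [b]) @ zs)"
      "set (([a, u] @ ys @ [b]) @ zs) = pverts G"
    using MNS_prefix_complete[OF _ ys(1)] by auto
  define \<sigma> where "\<sigma> = a # u # ys @ b # zs"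
  have mns: "MNS_ordering G \<sigma>"
    using MNS_ordering_if_prefix[OF zs] by (simp add: \<sigma>_def)
  have "u \<in> visited_nbrs G [a, u] b" "u \<notin> visited_nbrs G [a, u] c"
    using E N by (auto simp: visited_nbrs_def)
  then have "c \<notin> set ys" using ys(2) by blast
  then have "c \<in> set zs" using zs(2) V ne assms by auto
  then obtain zs1 zs2 where "zs = zs1 @ c # zs2" by (auto simp: in_set_conv_decomp)
  then have "\<sigma> = (a # u # ys @ b # zs1) @ c # zs2" by (simp add: \<sigma>_def)
  then have "precedes \<sigma> b c" unfolding precedes_iff_split by fastforce
  moreover have "\<sigma> = (a # u # ys) @ b # zs" by (simp add: \<sigma>_def)
  then have "precedes \<sigma> a b" unfolding precedes_iff_split by fastforce
  moreover have "\<not> precedes \<sigma> d a" for d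
  proof
    assume "precedes \<sigma> d a"
    then obtain ps qs where "\<sigma> = ps @ a # qs" "d \<in> set ps"
      by (auto simp: precedes_iff_split)
    moreover have "distinct \<sigma>"
      using MNS_prefix_distinct[OF zs(1)] by (simp add: \<sigma>_def)
    ultimately show False by (cases ps) (auto simp: \<sigma>_def)
  qed
  ultimately have "\<not> LexBFS_ordering G \<sigma>"
    using E N unfolding LexBFS_ordering_def by blast
  with mns show ?thesis by blast
qed

text \<open>An isomorphism of digraphs maps vertices and arcs separately. Here arcs are pairs on
  both sides, so the vertex map determines the arc map, and its inverse is the required embedding of
  \<open>H\<close> into \<open>G\<close>.\<close>

lemma induced_copy_embedding:
  assumes ind: "induced_subgraph K (with_proj G)" and iso: "digraph_iso K (with_proj H)"
  shows "\<exists>f. inj_on f (pverts H) \<and>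
    (\<forall>x \<in> pverts H. \<forall>y \<in> pverts H. (f x, f y) \<in> parcs G \<longleftrightarrow> (x, y) \<in> parcs H)"
proof -
  have K: "tail K = fst" "head K = snd"
    "arcs K = {e \<in> parcs G. fst e \<in> verts K \<and> snd e \<in> verts K}"
    using ind by (auto simp: induced_subgraph_def subgraph_def compatible_def)
  obtain h where h: "pre_digraph.digraph_isomorphism K h" and H: "with_proj H = app_iso h K"
    using iso by (auto simp: digraph_iso_def)
  let ?v = "iso_verts h"
  have vH: "pverts H = ?v ` verts K"
    using arg_cong[OF H, of verts] by simp
  have aH: "parcs H = iso_arcs h ` arcs K"
    using arg_cong[OF H, of arcs] by simp
  \<comment> \<open>\<open>app_iso\<close> takes its tail and head functions from \<open>h\<close>;
    equality with \<open>with_proj H\<close> makes them the projections.\<close>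
  have "iso_tail h = fst" "iso_head h = snd"
    using arg_cong[OF H, of tail] arg_cong[OF H, of head] by simp_all
  then have arc: "iso_arcs h e = (?v (fst e), ?v (snd e))" if "e \<in> arcs K" for e
    using h that K(1,2) by (simp add: pre_digraph.digraph_isomorphism_def prod_eq_iff)
  have inj: "inj_on ?v (verts K)"
    using h by (simp add: pre_digraph.digraph_isomorphism_def)
  have arcs: "(?v p, ?v q) \<in> parcs H \<longleftrightarrow> (p, q) \<in> parcs G" if "p \<in> verts K" "q \<in> verts K" for p q
  proof
    assume "(?v p, ?v q) \<in> parcs H"
    then obtain e where e: "e \<in> arcs K" "(?v p, ?v q) = (?v (fst e), ?v (snd e))"
      using aH arc by auto
    then have "p = fst e" "q = snd e"
      using K(3) that inj by (auto dest: inj_onD)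
    then show "(p, q) \<in> parcs G" using e K(3) by simp
  next
    assume "(p, q) \<in> parcs G"
    then have "(p, q) \<in> arcs K" using K(3) that by simp
    then show "(?v p, ?v q) \<in> parcs H" using aH arc by force
  qed
  let ?f = "the_inv_into (verts K) ?v"
  have "inj_on ?f (pverts H)"
    using inj vH by (simp add: inj_on_the_inv_into)
  moreover have "(?f x, ?f y) \<in> parcs G \<longleftrightarrow> (x, y) \<in> parcs H"
    if "x \<in> pverts H" "y \<in> pverts H" for x y
    using that inj arcs by (auto simp: vH the_inv_into_f_f)
  ultimately show ?thesis by blast
qed

theorem theorem5:
  fixes G :: "'a pair_pre_digraph"
  assumes "pair_graph G"
    and "connected (with_proj G)"
    and "\<And>\<sigma>. MNS_ordering G \<sigma> \<Longrightarrow> LexBFS_ordering G \<sigma>"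
  shows "induced_free {P4, C4} G"
  unfolding induced_free_def
proof
  assume "\<exists>H \<in> {P4, C4}. \<exists>K. induced_subgraph K (with_proj G) \<and> digraph_iso K (with_proj H)"
  then obtain H K where H: "H \<in> {P4, C4}"
    and K: "induced_subgraph K (with_proj G)" "digraph_iso K (with_proj H)"
    by blast
  obtain f where inj: "inj_on f (pverts H)"
    and f: "\<And>x y. x \<in> pverts H \<Longrightarrow> y \<in> pverts H \<Longrightarrow> (f x, f y) \<in> parcs G \<longleftrightarrow> (x, y) \<in> parcs H"
    using induced_copy_embedding[OF K] by blast
  have V: "pverts H = {0, 1, 2, 3}"
    using H by (auto simp: P4_def C4_def)
  \<comment> \<open>The pattern common to $P_4$ and $C_4$, which differ only in the pair 0, 3: the
    vertices 1, 2, 3, 0 serve as \<open>a\<close>, \<open>u\<close>, \<open>b\<close>,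
    \<open>c\<close>.\<close>
  have "(1, 2) \<in> parcs H" "(2, 3) \<in> parcs H" "(1, 0) \<in> parcs H"
    "(1, 3) \<notin> parcs H" "(2, 0) \<notin> parcs H"
    using H by (auto simp: P4_def C4_def)
  then have "(f 1, f 2) \<in> parcs G" "(f 2, f 3) \<in> parcs G" "(f 1, f 0) \<in> parcs G"
    "(f 1, f 3) \<notin> parcs G" "(f 2, f 0) \<notin> parcs G"
    using f V by auto
  moreover have "f 1 \<noteq> f 3" "f 2 \<noteq> f 0"
    using inj V by (auto simp: inj_on_def)
  ultimately obtain \<sigma> where "MNS_ordering G \<sigma>" "\<not> LexBFS_ordering G \<sigma>"
    using MNS_ordering_not_LexBFS[OF assms(1)] by blast
  then show False using assms(3) by blast
qed

end
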